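(* Let $G$ be a connected finite simple graph on $n$ vertices. Then the partial Petrial polynomial $P_G^\times(z)$ is binomial (that is, has exactly two nonzero terms) if and only if $G$ is a path.
   Context: All graphs are finite, simple and undirected. For a graph $G=(V,E)$ with $V=\{v_1,\dots,v_n\}$ and a subset $L\subseteq V$, let $\mathbf{A}_{(G,L)}=(a_{ij})$ be the $n\times n$ matrix over $\mathrm{GF}(2)$ with $a_{ij}=1$ if $i\neq j$ and $v_iv_j\in E$, $a_{ii}=1$ if $v_i\in L$, and all other entries $0$. Its corank is $\operatorname{corank}(\mathbf{A}_{(G,L)})=n-\operatorname{rank}(\mathbf{A}_{(G,L)})$, the rank being taken over $\mathrm{GF}(2)$. The partial Petrial polynomial of $G$ is the integer polynomial $$P_G^\times(z)=\sum_{L\subseteq V} z^{\,n-\operatorname{corank}(\mathbf{A}_{(G,L)})}.$$ A path means a path graph $P_n$ on $n\ge 1$ vertices (the single vertex $P_1$ is included). *)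

theory Defs
  imports
    "HOL-Library.Z2"
    "HOL-Computational_Algebra.Polynomial"
    "Jordan_Normal_Form.DL_Rank"
    "Graph_Theory.Graph_Theory"
begin

text \<open>
  A finite simple undirected graph is a \<^locale>\<open>pair_graph\<close>: the arc set is a finite, symmetric and
  irreflexive relation on the finite vertex set, the edge \<open>uv\<close> being represented by the two arcs
  \<open>(u, v)\<close> and \<open>(v, u)\<close>.

  As matrices are indexed by numbers, the vertices are numbered: \<open>v 0, \<dots>, v (n - 1)\<close> is an enumeration
  of the vertex set, that is, \<open>bij_betw v {..<n} (pverts G)\<close>. The field \<open>GF(2)\<close> is \<^typ>\<open>bit\<close>.
\<close>

definition adj_loop_mat ::
    "'a pair_pre_digraph \<Rightarrow> (nat \<Rightarrow> 'a) \<Rightarrow> nat \<Rightarrow> 'a set \<Rightarrow> bit mat" where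
  "adj_loop_mat G v n L =
     mat n n (\<lambda>(i, j). if i \<noteq> j \<and> (v i, v j) \<in> parcs G then 1
                       else if i = j \<and> v i \<in> L then 1
                       else 0)"

definition corank :: "nat \<Rightarrow> bit mat \<Rightarrow> nat" where
  "corank n A = n - vec_space.rank n A"

definition partial_petrial_poly ::
    "'a pair_pre_digraph \<Rightarrow> (nat \<Rightarrow> 'a) \<Rightarrow> nat \<Rightarrow> int poly" where
  "partial_petrial_poly G v n =
     (\<Sum>L \<in> Pow (pverts G). monom 1 (n - corank n (adj_loop_mat G v n L)))"

definition binomial_poly :: "int poly \<Rightarrow> bool" where
  "binomial_poly p \<longleftrightarrow> card {k. poly.coeff p k \<noteq> 0} = 2"

definition path_graph :: "nat \<Rightarrow> nat pair_pre_digraph" where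
  "path_graph m =
     \<lparr> pverts = {..<m},
       parcs = {(i, j). i < m \<and> j < m \<and> (j = i + 1 \<or> i = j + 1)} \<rparr>"

definition is_path :: "'a pair_pre_digraph \<Rightarrow> bool" where
  "is_path G \<longleftrightarrow> (\<exists>m \<ge> 1. digraph_iso (with_proj G) (with_proj (path_graph m)))"

end

theory Submission
  imports Defs "Jordan_Normal_Form.Matrix_Kernel"
begin

text \<open>
  The exponents of the polynomial are the ranks of the matrices \<open>A + diag(L)\<close>, where \<open>A\<close> is the
  adjacency matrix over \<open>GF(2)\<close>. By counting null
  vectors (\<open>card_mat_kernel_rank\<close>), a rank \<open>r\<close> corresponds to a null space with \<open>2 ^ (n - r)\<close> elements, so
  the polynomial is binomial iff exactly two sizes of null spaces occur when \<open>L\<close> varies.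

  The tool for comparing graphs is Gaussian elimination at a looped vertex \<open>v\<close>: over \<open>GF(2)\<close> it turns
  the graph into its local complement at \<open>v\<close> with \<open>v\<close> deleted, and it preserves the size of the null space
  (\<open>null_space_sizes_local_compl\<close>). As the loops may be chosen freely, each size that occurs for the smaller graph
  occurs for the given one. Going down to a single vertex, the sizes 1 and 2 always occur
  (\<open>one_two_in_null_space_sizes\<close>). So the polynomial is binomial iff no larger size occurs.

  For a path no larger size occurs, since a null vector is determined by its value at one end
  (\<open>null_space_sizes_path\<close>). For the converse, a graph with at least three vertices all of whose
  reductions are paths is itself a path (\<open>graph_path_of_local_compl\<close>). Hence a graph that is not a path can be
  reduced, without ever becoming a path, down to two isolated vertices, where the zero matrix
  has a null space of size 4 (\<open>large_null_space_if_not_path\<close>).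
\<close>

section \<open>Counting null vectors over a finite field\<close>

lemma (in vec_space) card_span_lin_indpt:
  assumes S: "S \<subseteq> carrier_vec n" "finite S" and indep: "lin_indpt S"
  shows "card (span S) = card (UNIV :: 'a set) ^ card S"
proof -
  let ?F = "PiE S (\<lambda>_. UNIV :: 'a set)"
  have inj: "inj_on (\<lambda>a. lincomb a S) ?F"
  proof (rule inj_onI, rule ccontr)
    fix a b assume ab: "a \<in> ?F" "b \<in> ?F" "lincomb a S = lincomb b S" "a \<noteq> b"
    then obtain s where s: "s \<in> S" "a s \<noteq> b s"
      by (meson PiE_ext)
    have "lincomb (\<lambda>x. a x - b x) S = 0\<^sub>v n"
    proof (rule eq_vecI)
      fix i assume "i < dim_vec (0\<^sub>v n :: 'a vec)"
      then have i: "i < n" by simp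
      have "(\<Sum>x\<in>S. a x * x $ i) = (\<Sum>x\<in>S. b x * x $ i)"
        using arg_cong[OF ab(3), of "\<lambda>w. w $ i"] by (simp add: lincomb_index[OF i S(1)])
      then show "lincomb (\<lambda>x. a x - b x) S $ i = 0\<^sub>v n $ i"
        using i by (simp add: lincomb_index[OF i S(1)] left_diff_distrib sum_subtractf)
    qed (use lincomb_dim[OF S(2,1)] in simp)
    then have "lin_dep S"
      using lin_dep_crit[OF S(2) subset_refl, where a = "\<lambda>x. a x - b x" and v = s] s by simp
    with indep show False by simp
  qed
  have "span S = (\<lambda>a. lincomb a S) ` ?F"
  proof -
    have "lincomb a S \<in> (\<lambda>a. lincomb a S) ` ?F" for a
      by (rule image_eqI[of _ _ "restrict a S"], rule lincomb_cong) (use S in auto)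
    then show ?thesis
      using finite_span[OF S(2)] S(1) by auto
  qed
  then show ?thesis
    by (simp add: card_image[OF inj] card_PiE[OF S(2)])
qed

text \<open>
  Counting form of the rank-nullity theorem: the nonempty fibres of \<open>x \<mapsto> A x\<close> are translates of the
  kernel, and the image is the column space, which has \<open>q ^ rank A\<close> elements over a field with \<open>q\<close>
  elements. It turns statements about the corank into statements about the number of null vectors,
  and null vectors are easy to carry from one graph to another.
\<close>

lemma (in vec_space) card_mat_kernel_rank:
  assumes A: "A \<in> carrier_mat n nc" and fin: "finite (UNIV :: 'a set)"
  shows "card (mat_kernel A) * card (UNIV :: 'a set) ^ rank A = card (UNIV :: 'a set) ^ nc"
proof -
  let ?C = "set (cols A)"
  have C: "?C \<subseteq> carrier_vec n" "finite ?C"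
    using A cols_dim by blast+
  obtain S where max: "maximal S (\<lambda>T. T \<subseteq> ?C \<and> lin_indpt T)"
    using maximal_exists[of "\<lambda>T. T \<subseteq> ?C \<and> lin_indpt T" "card ?C" "{}"]
    by (meson List.finite_set card_mono empty_iff empty_subsetI finite_lin_indpt2 rev_finite_subset)
  have S: "S \<subseteq> ?C" "lin_indpt S" "finite S"
    using max C(2) by (auto simp: maximal_def intro: finite_subset)
  have "?C \<subseteq> span S"
  proof
    fix c assume c: "c \<in> ?C"
    show "c \<in> span S"
    proof (rule ccontr)
      assume nc: "c \<notin> span S"
      then have "lin_indpt (S \<union> {c})"
        using lin_dep_iff_in_span[of S c] S C c by (meson span_mem subset_iff)
      moreover have "c \<notin> S"
        using nc S(1) C(1) by (meson in_own_span subset_iff subset_trans)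
      ultimately show False
        using max S(1) c unfolding maximal_def by blast
    qed
  qed
  then have "span S = span ?C"
    using span_is_monotone[OF S(1)] span_subsetI[of S ?C] C S(1) by blast
  then have card_image: "card (col_space A) = card (UNIV :: 'a set) ^ rank A"
    using card_span_lin_indpt[of S] S C rank_card_indpt[OF A max] by (auto simp: col_space_def)
  have image: "col_space A = (\<lambda>x. A *\<^sub>v x) ` carrier_vec nc"
    using col_space_eq[OF A] A by auto
  have bij: "bij_betw (\<lambda>x. vec nc x) (PiE {..<nc} (\<lambda>_. UNIV :: 'a set)) (carrier_vec nc)"
    by (rule bij_betwI[where g = "\<lambda>w. restrict (\<lambda>i. w $ i) {..<nc}"]) (auto simp: fun_eq_iff PiE_def extensional_def)
  have cardV: "card (carrier_vec nc :: 'a vec set) = card (UNIV :: 'a set) ^ nc"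
    using bij_betw_same_card[OF bij] by (simp add: card_PiE)
  have finV: "finite (carrier_vec nc :: 'a vec set)"
    using bij_betw_finite[OF bij] fin by (simp add: finite_PiE)
  have fibre: "card {x \<in> carrier_vec nc. A *\<^sub>v x = y} = card (mat_kernel A)" if y: "y \<in> col_space A" for y
  proof -
    obtain z where z: "z \<in> carrier_vec nc" "y = A *\<^sub>v z"
      using y image by blast
    have "bij_betw (\<lambda>x. x + z) (mat_kernel A) {x \<in> carrier_vec nc. A *\<^sub>v x = y}"
      by (rule bij_betwI[where g = "\<lambda>x. x - z"])
        (use A z in \<open>auto simp: mat_kernel[OF A] mult_add_distrib_mat_vec mult_minus_distrib_mat_vec\<close>)
    then show ?thesis
      by (simp add: bij_betw_same_card)
  qed
  have "card (carrier_vec nc :: 'a vec set) = (\<Sum>y\<in>col_space A. card {x \<in> carrier_vec nc. A *\<^sub>v x = y})"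
    using sum.group[OF finV, of "col_space A" "\<lambda>x. A *\<^sub>v x" "\<lambda>_. 1 :: nat"] image finV by simp
  then show ?thesis
    using fibre card_image cardV by simp
qed

section \<open>Null spaces of graphs with loops and local complementation\<close>

text \<open>
  Matrices are indexed by the vertices themselves, so that a vertex can be deleted without
  renumbering. Vectors vanish outside \<open>V\<close>, so that each vector is a single function and vectors
  can be counted.
\<close>

definition null_space :: "'a set \<Rightarrow> ('a \<Rightarrow> 'a \<Rightarrow> 'b :: comm_ring_1) \<Rightarrow> ('a \<Rightarrow> 'b) set" where
  "null_space V a = {x. (\<forall>w. w \<notin> V \<longrightarrow> x w = 0) \<and> (\<forall>u\<in>V. (\<Sum>w\<in>V. a u w * x w) = 0)}"

definition adj :: "('a \<times> 'a) set \<Rightarrow> 'a set \<Rightarrow> 'a \<Rightarrow> 'a \<Rightarrow> bit" where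
  "adj E L u w = of_bool ((u, w) \<in> E \<or> (u = w \<and> u \<in> L))"

definition null_space_sizes :: "'a set \<Rightarrow> ('a \<times> 'a) set \<Rightarrow> nat set" where
  "null_space_sizes V E = (\<lambda>L. card (null_space V (adj E L))) ` Pow V"

definition local_compl :: "('a \<times> 'a) set \<Rightarrow> 'a \<Rightarrow> ('a \<times> 'a) set" where
  "local_compl E v = {(a, b). ((a, b) \<in> E) \<noteq> (a \<noteq> b \<and> (v, a) \<in> E \<and> (v, b) \<in> E)}"

definition graph_path :: "'a set \<Rightarrow> ('a \<times> 'a) set \<Rightarrow> 'a list \<Rightarrow> bool" where
  "graph_path V E p \<longleftrightarrow> p \<noteq> [] \<and> distinct p \<and> set p = V \<and>
     (\<forall>i<length p. \<forall>j<length p. (p ! i, p ! j) \<in> E \<longleftrightarrow> j = Suc i \<or> i = Suc j)"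

text \<open>
  Elimination with the pivot \<open>a v v = 1\<close>: row \<open>v\<close> expresses \<open>x v\<close> through the other coordinates, and
  substituting this into the other rows leaves the system of the Schur complement.
\<close>

lemma card_null_space_Schur:
  fixes a :: "'a \<Rightarrow> 'a \<Rightarrow> 'b :: comm_ring_1"
  assumes V: "finite V" "v \<in> V" and avv: "a v v = 1"
  shows "card (null_space V a) = card (null_space (V - {v}) (\<lambda>u w. a u w - a u v * a v w))"
proof -
  let ?W = "V - {v}" and ?b = "\<lambda>u w. a u w - a u v * a v w"
  define f where "f x = x(v := - (\<Sum>w\<in>?W. a v w * x w))" for x :: "'a \<Rightarrow> 'b"
  have split: "(\<Sum>w\<in>V. a u w * x w) = a u v * x v + (\<Sum>w\<in>?W. a u w * x w)" for u x
    using V by (simp add: sum.remove)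
  have schur: "(\<Sum>w\<in>?W. ?b u w * x w) = (\<Sum>w\<in>?W. a u w * x w) - a u v * (\<Sum>w\<in>?W. a v w * x w)" for u x
    by (simp add: left_diff_distrib sum_subtractf sum_distrib_left mult.assoc)
  have cong: "(\<Sum>w\<in>?W. c w * (x(v := k)) w) = (\<Sum>w\<in>?W. c w * x w)" for c x k
    by (rule sum.cong) auto
  have xv: "x v = - (\<Sum>w\<in>?W. a v w * x w)" if "x \<in> null_space V a" for x
  proof -
    have "(\<Sum>w\<in>V. a v w * x w) = 0"
      using that V by (simp add: null_space_def)
    then have "x v + (\<Sum>w\<in>?W. a v w * x w) = 0"
      by (simp add: split avv)
    then show ?thesis
      by (simp add: eq_neg_iff_add_eq_0)
  qed
  have "bij_betw f (null_space ?W ?b) (null_space V a)"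
  proof (rule bij_betwI[where g = "\<lambda>x. x(v := 0)"])
    show "f \<in> null_space ?W ?b \<rightarrow> null_space V a"
    proof
      fix x assume x: "x \<in> null_space ?W ?b"
      have "(\<Sum>w\<in>V. a u w * f x w) = 0" if u: "u \<in> V" for u
      proof (cases "u = v")
        case True
        then show ?thesis
          unfolding split f_def cong by (simp add: avv)
      next
        case False
        then have "(\<Sum>w\<in>?W. ?b u w * x w) = 0"
          using x u by (simp add: null_space_def)
        then show ?thesis
          unfolding split f_def schur cong by simp
      qed
      moreover have "f x w = 0" if "w \<notin> V" for w
        using x that V by (auto simp: f_def null_space_def)
      ultimately show "f x \<in> null_space V a"
        by (simp add: null_space_def)
    qed
    show "(\<lambda>x. x(v := 0)) \<in> null_space V a \<rightarrow> null_space ?W ?b"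
    proof
      fix x assume x: "x \<in> null_space V a"
      have "(\<Sum>w\<in>?W. ?b u w * (x(v := 0)) w) = 0" if u: "u \<in> ?W" for u
      proof -
        have "(\<Sum>w\<in>V. a u w * x w) = 0"
          using x u by (simp add: null_space_def)
        then show ?thesis
          unfolding cong schur split xv[OF x] by simp
      qed
      then show "x(v := 0) \<in> null_space ?W ?b"
        using x by (auto simp: null_space_def)
    qed
    show "(f x)(v := 0) = x" if "x \<in> null_space ?W ?b" for x
      using that by (auto simp: f_def null_space_def)
    show "f (x(v := 0)) = x" if "x \<in> null_space V a" for x
      unfolding f_def cong using xv[OF that] by auto
  qed
  then show ?thesis
    by (simp add: bij_betw_same_card)
qed

lemma null_space_cong:
  assumes "\<And>u w. u \<in> V \<Longrightarrow> w \<in> V \<Longrightarrow> a u w = b u w"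
  shows "null_space V a = null_space V b"
  using assms by (simp add: null_space_def)

text \<open>
  Over \<open>GF(2)\<close>, the Schur complement at a looped vertex \<open>v\<close> adds 1 to each entry \<open>(u, w)\<close> for which
  \<open>u\<close> and \<open>w\<close> are both neighbours of \<open>v\<close>. Off the diagonal this is local complementation at \<open>v\<close>; on
  the diagonal it toggles the loops at the neighbours of \<open>v\<close>, which the choice of loops can undo.
\<close>

lemma null_space_sizes_local_compl:
  assumes V: "finite V" "v \<in> V" and E: "sym E" "irrefl E"
  shows "null_space_sizes (V - {v}) (local_compl E v) \<subseteq> null_space_sizes V E"
proof
  fix k assume "k \<in> null_space_sizes (V - {v}) (local_compl E v)"
  then obtain L where L: "L \<subseteq> V - {v}" "k = card (null_space (V - {v}) (adj (local_compl E v) L))"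
    by (auto simp: null_space_sizes_def)
  define M where "M = {u \<in> V. u = v \<or> (u \<in> L) \<noteq> ((v, u) \<in> E)}"
  have vv: "adj E M v v = 1"
    using V by (simp add: adj_def M_def)
  have "adj E M u w - adj E M u v * adj E M v w = adj (local_compl E v) L u w"
    if "u \<in> V - {v}" "w \<in> V - {v}" for u w
  proof -
    have uv: "(u, v) \<in> E \<longleftrightarrow> (v, u) \<in> E"
      using E(1) by (auto dest: symD)
    have M: "u \<in> M \<longleftrightarrow> (u \<in> L) \<noteq> ((v, u) \<in> E)" and uu: "(u, u) \<notin> E" and "u \<noteq> v" "w \<noteq> v"
      and wv: "(w, v) \<in> E \<longleftrightarrow> (v, w) \<in> E"
      using that E by (auto simp: M_def irrefl_def dest: symD)
    then show ?thesis
      by (cases "u = w"; cases "(v, u) \<in> E"; cases "(v, w) \<in> E"; cases "(u, w) \<in> E")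
        (simp_all add: adj_def local_compl_def uv wv)
  qed
  then have "k = card (null_space V (adj E M))"
    unfolding L(2) card_null_space_Schur[where a = "adj E M", OF V vv] by (intro arg_cong[where f = card] null_space_cong) auto
  then show "k \<in> null_space_sizes V E"
    unfolding null_space_sizes_def by (intro image_eqI[of _ _ M]) (auto simp: M_def)
qed

lemma null_space_singleton:
  "null_space {v} a = (if a v v = 0 then {\<lambda>_. 0, (\<lambda>_. 0)(v := 1 :: bit)} else {\<lambda>_. 0})"
proof -
  have "x \<in> null_space {v} a \<longleftrightarrow> (\<forall>w. w \<noteq> v \<longrightarrow> x w = 0) \<and> a v v * x v = 0" for x
  proof -
    have "sum f {v} = f v" for f :: "'a \<Rightarrow> bit"
      by simp
    then show ?thesis
      unfolding null_space_def by auto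
  qed
  moreover have "(\<forall>w. w \<noteq> v \<longrightarrow> x w = 0) \<longleftrightarrow> x = (\<lambda>_. 0) \<or> x = (\<lambda>_. 0)(v := 1)" for x :: "'a \<Rightarrow> bit"
    by (cases "x v") (auto simp: fun_eq_iff)
  ultimately show ?thesis
    by (cases "a v v") auto
qed

lemma local_compl_sym: "sym E \<Longrightarrow> sym (local_compl E v)"
  by (auto simp: sym_def local_compl_def)

lemma local_compl_irrefl: "irrefl E \<Longrightarrow> irrefl (local_compl E v)"
  by (auto simp: irrefl_def local_compl_def)

text \<open>
  A single vertex has null spaces of both sizes, with and without its loop, and elimination of a
  looped vertex reduces every other graph to a smaller one.
\<close>

lemma one_two_in_null_space_sizes:
  assumes "finite V" "V \<noteq> {}" "sym E" "irrefl E"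
  shows "{1, 2} \<subseteq> null_space_sizes V E"
  using assms
proof (induction "card V" arbitrary: V E rule: less_induct)
  case less
  then obtain v where v: "v \<in> V"
    by blast
  show ?case
  proof (cases "V = {v}")
    case True
    have "(\<lambda>_. 0) \<noteq> (\<lambda>_. 0 :: bit)(v := 1)"
      by (auto simp: fun_eq_iff)
    then have "card (null_space V (adj E {})) = 2" "card (null_space V (adj E {v})) = 1"
      using True less.prems(4) by (auto simp: null_space_singleton adj_def irrefl_def)
    then have "2 \<in> null_space_sizes V E" "1 \<in> null_space_sizes V E"
      unfolding null_space_sizes_def by (metis Pow_bottom imageI, metis Pow_top True imageI)
    then show ?thesis
      by simp
  next
    case False
    then have "{1, 2} \<subseteq> null_space_sizes (V - {v}) (local_compl E v)"
      using less.prems v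
      by (intro less.hyps[OF card_Diff1_less]) (auto simp: local_compl_sym local_compl_irrefl)
    then show ?thesis
      using null_space_sizes_local_compl[OF less.prems(1) v less.prems(3,4)] by blast
  qed
qed

text \<open>
  Along a path, row \<open>h\<close> of the system determines the coordinate at position \<open>h + 1\<close> from the earlier
  ones. Hence a null vector is determined by its first coordinate, whatever the loops are.
\<close>

lemma null_space_sizes_path:
  assumes p: "graph_path V E p"
  shows "null_space_sizes V E \<subseteq> {1, 2}"
proof
  fix k assume "k \<in> null_space_sizes V E"
  then obtain L where k: "k = card (null_space V (adj E L))"
    by (auto simp: null_space_sizes_def)
  let ?N = "null_space V (adj E L)"
  have p0: "0 < length p" and dist: "distinct p" and V: "V = set p"
    and edge: "\<And>i j. i < length p \<Longrightarrow> j < length p \<Longrightarrow> (p ! i, p ! j) \<in> E \<longleftrightarrow> j = Suc i \<or> i = Suc j"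
    using p by (auto simp: graph_path_def)
  have "inj_on (\<lambda>x. x (p ! 0)) ?N"
  proof (rule inj_onI)
    fix x y assume x: "x \<in> ?N" and y: "y \<in> ?N" and eq: "x (p ! 0) = y (p ! 0)"
    have step: "x (p ! i) = y (p ! i)" if "i < length p" for i
      using that
    proof (induction i rule: less_induct)
      case (less i)
      show ?case
      proof (cases i)
        case 0
        then show ?thesis
          using eq by simp
      next
        case (Suc h)
        have h: "p ! h \<in> V" and i: "p ! i \<in> V" 
          using V Suc less.prems by auto
        \<comment> \<open>Row \<open>h\<close> has nonzero entries only at positions up to \<open>h + 1 = i\<close>.\<close>
        have same: "adj E L (p ! h) w * x w = adj E L (p ! h) w * y w" if w: "w \<in> V - {p ! i}" for w
        proof -
          obtain j where j: "j < length p" "w = p ! j" "j \<noteq> i"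
            using w V by (auto simp: in_set_conv_nth)
          show ?thesis
          proof (cases "j < i")
            case True
            then show ?thesis
              using less.IH[of j] j by simp
          next
            case False
            then have "adj E L (p ! h) w = 0"
              using j Suc edge[of h j] less.prems dist by (auto simp: adj_def nth_eq_iff_index_eq)
            then show ?thesis
              by simp
          qed
        qed
        have one: "adj E L (p ! h) (p ! i) = 1"
          using edge[of h i] Suc less.prems by (simp add: adj_def)
        have "(\<Sum>w\<in>V. adj E L (p ! h) w * x w) = (\<Sum>w\<in>V. adj E L (p ! h) w * y w)"
          using x y h by (simp add: null_space_def)
        then have "adj E L (p ! h) (p ! i) * x (p ! i) + (\<Sum>w\<in>V - {p ! i}. adj E L (p ! h) w * x w) =
            adj E L (p ! h) (p ! i) * y (p ! i) + (\<Sum>w\<in>V - {p ! i}. adj E L (p ! h) w * y w)"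
          using V i by (simp only: sum.remove finite_set)
        moreover have "(\<Sum>w\<in>V - {p ! i}. adj E L (p ! h) w * x w) = (\<Sum>w\<in>V - {p ! i}. adj E L (p ! h) w * y w)"
          using same by (rule sum.cong[OF refl])
        ultimately show ?thesis
          by (simp only: one mult_1_left add_right_cancel)
      qed
    qed
    show "x = y"
    proof
      fix w
      show "x w = y w"
      proof (cases "w \<in> V")
        case True
        then show ?thesis
          using step V by (auto simp: in_set_conv_nth)
      next
        case False
        then show ?thesis
          using x y by (simp add: null_space_def)
      qed
    qed
  qed
  moreover have univ: "(UNIV :: bit set) = {0, 1}"
    by (auto intro: bit.exhaust)
  have "(\<lambda>x. x (p ! 0)) ` ?N \<subseteq> {0, 1}"
    using univ by blast
  ultimately have "finite ?N" "card ?N \<le> 2"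
    using card_inj_on_le[of "\<lambda>x. x (p ! 0)" ?N "{0, 1}"] inj_on_finite by fastforce+
  moreover have "(\<lambda>_. 0) \<in> ?N"
    by (simp add: null_space_def)
  ultimately have "card ?N \<noteq> 0"
    by auto
  with \<open>card ?N \<le> 2\<close> show "k \<in> {1, 2}"
    unfolding k by auto
qed

section \<open>Graphs whose local complements are paths\<close>

lemma graph_path_edge:
  assumes "graph_path V E p" "i < length p" "j < length p"
  shows "(p ! i, p ! j) \<in> E \<longleftrightarrow> j = Suc i \<or> i = Suc j"
  using assms by (simp add: graph_path_def)

lemma graph_path_obtain_index:
  assumes "graph_path V E p" "x \<in> V"
  obtains i where "i < length p" "x = p ! i"
  using assms by (auto simp: graph_path_def in_set_conv_nth)

lemma graph_path_no_claw:
  assumes p: "graph_path V E p" and V: "x \<in> V" "a \<in> V" "b \<in> V" "c \<in> V"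
    and adj: "(x, a) \<in> E" "(x, b) \<in> E" "(x, c) \<in> E"
  shows "a = b \<or> a = c \<or> b = c"
proof -
  obtain i j k l where "i < length p" "x = p ! i" "j < length p" "a = p ! j"
      "k < length p" "b = p ! k" "l < length p" "c = p ! l"
    using graph_path_obtain_index[OF p] V by metis
  then show ?thesis
    using adj graph_path_edge[OF p] by fastforce
qed

lemma graph_path_no_triangle:
  assumes p: "graph_path V E p" and V: "a \<in> V" "b \<in> V" "c \<in> V"
    and adj: "(a, b) \<in> E" "(a, c) \<in> E" "(b, c) \<in> E"
  shows False
proof -
  obtain j k l where "j < length p" "a = p ! j" "k < length p" "b = p ! k" "l < length p" "c = p ! l"
    using graph_path_obtain_index[OF p] V by metis
  then show ?thesis
    using adj graph_path_edge[OF p] by fastforce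
qed

lemma graph_path_neighbour:
  assumes p: "graph_path V E p" and V: "x \<in> V" "y \<in> V" "x \<noteq> y"
  shows "\<exists>w\<in>V. (x, w) \<in> E"
proof -
  obtain i j where ij: "i < length p" "x = p ! i" "j < length p" "y = p ! j"
    using graph_path_obtain_index[OF p] V by metis
  define k where "k = (if i = 0 then 1 else i - 1)"
  have "k < length p" "k = Suc i \<or> i = Suc k"
    using ij V(3) by (cases i; cases j; auto simp: k_def)+
  moreover have "p ! k \<in> V"
    using p \<open>k < length p\<close> by (auto simp: graph_path_def)
  ultimately show ?thesis
    using graph_path_edge[OF p ij(1)] ij(2) by blast
qed

lemma graph_path_rev:
  assumes "graph_path V E p"
  shows "graph_path V E (rev p)"
  unfolding graph_path_def
proof (intro conjI allI impI)
  fix i j assume ij: "i < length (rev p)" "j < length (rev p)"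
  then have "(rev p ! i, rev p ! j) \<in> E \<longleftrightarrow> length p - Suc j = Suc (length p - Suc i) \<or> length p - Suc i = Suc (length p - Suc j)"
    using graph_path_edge[OF assms] by (simp add: rev_nth)
  also have "\<dots> \<longleftrightarrow> j = Suc i \<or> i = Suc j"
    using ij by auto
  finally show "(rev p ! i, rev p ! j) \<in> E \<longleftrightarrow> j = Suc i \<or> i = Suc j" .
qed (use assms in \<open>auto simp: graph_path_def\<close>)

lemma graph_path_Cons:
  assumes E: "sym E" "irrefl E" and q: "graph_path (V - {e}) E q" and e: "e \<in> V"
    and nb: "\<And>w. w \<in> V \<Longrightarrow> (e, w) \<in> E \<longleftrightarrow> w = q ! 0"
  shows "graph_path V E (e # q)"
  unfolding graph_path_def
proof (intro conjI allI impI)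
  have q': "q \<noteq> []" "distinct q" "set q = V - {e}"
    using q by (auto simp: graph_path_def)
  show "distinct (e # q)" "set (e # q) = V"
    using q' e by auto
  have nb_nth: "(e, q ! i) \<in> E \<longleftrightarrow> i = 0" if i: "i < length q" for i
  proof -
    have "q ! i \<in> V"
      using q' i by (metis DiffD1 nth_mem)
    then show ?thesis
      using nb q' i by (simp add: nth_eq_iff_index_eq)
  qed
  fix i j assume ij: "i < length (e # q)" "j < length (e # q)"
  show "((e # q) ! i, (e # q) ! j) \<in> E \<longleftrightarrow> j = Suc i \<or> i = Suc j"
  proof (cases i; cases j)
    fix i' j' assume "i = Suc i'" "j = Suc j'"
    then show ?thesis
      using ij graph_path_edge[OF q] by simp
  next
    fix j' assume "i = 0" "j = Suc j'"
    then show ?thesis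
      using ij nb_nth[of j'] by simp
  next
    fix i' assume "i = Suc i'" "j = 0"
    then show ?thesis
      using ij nb_nth[of i'] E(1) by (auto dest: symD)
  next
    assume "i = 0" "j = 0"
    then show ?thesis
      using E(2) by (simp add: irrefl_def)
  qed
qed simp

lemma graph_path_cong:
  assumes "\<And>a b. a \<in> V \<Longrightarrow> b \<in> V \<Longrightarrow> (a, b) \<in> E \<longleftrightarrow> (a, b) \<in> F"
  shows "graph_path V E p \<longleftrightarrow> graph_path V F p"
  unfolding graph_path_def using assms by (metis nth_mem)

text \<open>
  Local complementation at a leaf \<open>e\<close> changes no edge, so \<open>V - {e}\<close> is a path in \<open>E\<close> itself. If the leaf
  were attached at an inner vertex \<open>e'\<close> of this path, then \<open>e\<close> and the two path neighbours of \<open>e'\<close> would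
  be pairwise nonadjacent, and local complementation at \<open>e'\<close> would make them a triangle.
\<close>

lemma graph_path_of_leaf:
  assumes E: "sym E" "irrefl E" and e: "e \<in> V" and nb: "\<And>w. w \<in> V \<Longrightarrow> (e, w) \<in> E \<longleftrightarrow> w = e'"
    and e': "e' \<in> V"
    and all: "\<And>v. v \<in> V \<Longrightarrow> \<exists>p. graph_path (V - {v}) (local_compl E v) p"
  shows "\<exists>p. graph_path V E p"
proof -
  obtain q where "graph_path (V - {e}) (local_compl E e) q"
    using all e by blast
  then have q: "graph_path (V - {e}) E q"
    using nb by (subst graph_path_cong[of _ _ "local_compl E e"]) (auto simp: local_compl_def)
  have "e' \<noteq> e"
    using nb[OF e'] E(2) by (auto simp: irrefl_def)
  then obtain k where k: "k < length q" "e' = q ! k"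
    using graph_path_obtain_index[OF q] e' by blast
  have dist: "distinct q" and set: "set q = V - {e}"
    using q by (auto simp: graph_path_def)
  consider "k = 0" | "k = length q - 1" | "0 < k" "k + 1 < length q"
    using k(1) by linarith
  then show ?thesis
  proof cases
    case 1
    then show ?thesis
      using graph_path_Cons[OF E q e] nb k(2) by blast
  next
    case 2
    moreover have "rev q ! 0 = q ! (length q - Suc 0)"
      using k(1) by (intro rev_nth) auto
    ultimately have "e' = rev q ! 0"
      using k(2) by simp
    then show ?thesis
      using graph_path_Cons[OF E graph_path_rev[OF q] e] nb by blast
  next
    case 3
    let ?a = "q ! (k - 1)" and ?b = "q ! (k + 1)"
    have V: "?a \<in> V - {e}" "?b \<in> V - {e}"
      using 3 k set by (metis less_imp_diff_less nth_mem, metis nth_mem)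
    have ne: "?a \<noteq> e'" "?b \<noteq> e'" "?a \<noteq> ?b"
      using 3 k dist by (auto simp: nth_eq_iff_index_eq)
    have "(?a, ?b) \<notin> E" "(e', ?a) \<in> E" "(e', ?b) \<in> E"
      using 3 k graph_path_edge[OF q] by auto
    moreover have "(e', e) \<in> E"
      using nb e' E(1) by (metis symD)
    moreover have "(e, ?a) \<notin> E" "(e, ?b) \<notin> E"
      using nb V ne by auto
    ultimately have "(e, ?a) \<in> local_compl E e'" "(e, ?b) \<in> local_compl E e'" "(?a, ?b) \<in> local_compl E e'"
      using V ne by (auto simp: local_compl_def)
    moreover obtain r where "graph_path (V - {e'}) (local_compl E e') r"
      using all e' by blast
    ultimately have False
      using graph_path_no_triangle[of "V - {e'}" "local_compl E e'" r e ?a ?b] V ne e \<open>e' \<noteq> e\<close> by blast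
    then show ?thesis ..
  qed
qed

text \<open>
  This is the combinatorial core. Fix \<open>v\<close> and let \<open>p\<close> be the path that arises at \<open>v\<close>. Two positions of \<open>p\<close>
  are adjacent in \<open>E\<close> if they are consecutive, except that this is reversed when both are neighbours of
  \<open>v\<close>. An end of \<open>p\<close> that is not a neighbour of \<open>v\<close> is a leaf. Otherwise both ends are neighbours
  of \<open>v\<close>, and unless \<open>E\<close> is the path on three vertices with middle \<open>v\<close>, local complementation at a suitable
  position of \<open>p\<close> produces a triangle, a vertex of degree at least three or an isolated vertex,
  none of which occurs in a path with at least two vertices.
\<close>

lemma graph_path_of_local_compl:
  assumes fin: "finite V" and card: "3 \<le> card V" and E: "sym E" "irrefl E"
    and all: "\<And>v. v \<in> V \<Longrightarrow> \<exists>p. graph_path (V - {v}) (local_compl E v) p"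
  shows "\<exists>p. graph_path V E p"
proof -
  have sym: "(a, b) \<in> E \<longleftrightarrow> (b, a) \<in> E" for a b
    using E(1) by (auto dest: symD)
  have irr: "(a, a) \<notin> E" for a
    using E(2) by (simp add: irrefl_def)
  obtain v where v: "v \<in> V"
    using card by fastforce
  then obtain p where p: "graph_path (V - {v}) (local_compl E v) p"
    using all by blast
  let ?m = "length p"
  have dist: "distinct p" and setp: "set p = V - {v}"
    using p by (auto simp: graph_path_def)
  have m: "2 \<le> ?m"
    using card v fin distinct_card[OF dist] setp by simp
  have mem: "p ! i \<in> V" "p ! i \<noteq> v" if "i < ?m" for i
    using nth_mem[OF that] setp by auto
  have neq: "p ! i = p ! j \<longleftrightarrow> i = j" if "i < ?m" "j < ?m" for i j
    using that dist by (simp add: nth_eq_iff_index_eq)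
  define N where "N i \<longleftrightarrow> (v, p ! i) \<in> E" for i
  have edge: "(p ! i, p ! j) \<in> E \<longleftrightarrow> (j = Suc i \<or> i = Suc j) \<noteq> (i \<noteq> j \<and> N i \<and> N j)"
    if "i < ?m" "j < ?m" for i j
    using graph_path_edge[OF p that] neq[OF that] by (auto simp: local_compl_def N_def)
  have nbv: "(p ! i, v) \<in> E \<longleftrightarrow> N i" for i
    using sym[of v "p ! i"] by (simp add: N_def)
  have end_not_nb: ?thesis
    if q: "graph_path (V - {v}) (local_compl E v) q" and "(v, q ! 0) \<notin> E" for q
  proof (rule graph_path_of_leaf[OF E, of "q ! 0" V "q ! 1"])
    have q': "distinct q" "set q = V - {v}" "q \<noteq> []"
      using q by (auto simp: graph_path_def)
    have l: "2 \<le> length q"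
      using card v fin distinct_card[OF q'(1)] q'(2) by simp
    then have "0 < length q" "1 < length q"
      by auto
    then show "q ! 0 \<in> V" "q ! 1 \<in> V"
      using q'(2) nth_mem by blast+
    show "(q ! 0, w) \<in> E \<longleftrightarrow> w = q ! 1" if w: "w \<in> V" for w
    proof (cases "w = v")
      case True
      then show ?thesis
        using that \<open>(v, q ! 0) \<notin> E\<close> sym[of v] nth_mem[of 1 q] l q' by auto
    next
      case False
      then obtain j where j: "j < length q" "w = q ! j"
        using w graph_path_obtain_index[OF q] by blast
      then show ?thesis
        using graph_path_edge[OF q, of 0 j] \<open>(v, q ! 0) \<notin> E\<close> l q'(1,3)
        by (auto simp: local_compl_def nth_eq_iff_index_eq)
    qed
  qed (use all in blast)
  consider "\<not> N 0" | "\<not> N (?m - 1)" | "\<And>i. i < ?m \<Longrightarrow> N i" | "N 0" "N (?m - 1)" "\<exists>i<?m. \<not> N i"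
    by blast
  then show ?thesis
  proof cases
    case 1
    then show ?thesis
      using end_not_nb[OF p] by (simp add: N_def)
  next
    case 2
    moreover have "rev p ! 0 = p ! (?m - Suc 0)"
      using m by (intro rev_nth) auto
    ultimately have "(v, rev p ! 0) \<notin> E"
      by (simp add: N_def)
    then show ?thesis
      using end_not_nb[OF graph_path_rev[OF p]] by simp
  next
    case 3
    show ?thesis
    proof (cases "?m = 2")
      case True
      have "graph_path V E [p ! 0, v, p ! 1]"
      proof -
        have "p = [p ! 0, p ! 1]"
          using True by (cases p rule: list.exhaust; cases "tl p") auto
        then have "V = {p ! 0, v, p ! 1}"
          using setp v by (metis insert_Diff insert_commute list.simps(15) set_empty empty_set)
        moreover have "(v, p ! 0) \<in> E" "(v, p ! 1) \<in> E" "(p ! 0, p ! 1) \<notin> E" "p ! 0 \<noteq> p ! 1" "p ! 0 \<noteq> v" "p ! 1 \<noteq> v"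
          using 3 edge[of 0 1] neq[of 0 1] mem[of 0] mem[of 1] True by (auto simp: N_def)
        ultimately show ?thesis
          using sym irr by (auto simp: graph_path_def less_Suc_eq numeral_3_eq_3)
      qed
      then show ?thesis
        by blast
    next
      case False
      with m have m3: "0 < ?m" "1 < ?m" "2 < ?m"
        by linarith+
      obtain q where q: "graph_path (V - {p ! 1}) (local_compl E (p ! 1)) q"
        using all mem[of 1] m by force
      \<comment> \<open>Local complementation at \<open>p ! 1\<close>, which is adjacent to neither \<open>p ! 0\<close> nor \<open>p ! 2\<close>, leaves this triangle intact.\<close>
      have "(p ! 1, p ! 0) \<notin> E" "(p ! 1, p ! 2) \<notin> E" "(p ! 0, p ! 2) \<in> E" "(v, p ! 0) \<in> E" "(v, p ! 2) \<in> E"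
        using edge[OF m3(2,1)] edge[OF m3(2,3)] edge[OF m3(1,3)] 3[OF m3(1)] 3[OF m3(2)] 3[OF m3(3)]
        by (simp_all add: N_def)
      then have "(v, p ! 0) \<in> local_compl E (p ! 1)" "(v, p ! 2) \<in> local_compl E (p ! 1)" "(p ! 0, p ! 2) \<in> local_compl E (p ! 1)"
        by (auto simp: local_compl_def)
      moreover have "v \<in> V - {p ! 1}" "p ! 0 \<in> V - {p ! 1}" "p ! 2 \<in> V - {p ! 1}"
        using v mem[OF m3(1)] mem[OF m3(2)] mem[OF m3(3)] neq[OF m3(1,2)] neq[OF m3(3,2)] by auto
      ultimately have False
        using graph_path_no_triangle[OF q] by blast
      then show ?thesis ..
    qed
  next
    case 4
    \<comment> \<open>A position at which the path leaves the neighbourhood of \<open>v\<close>.\<close>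
    have "\<exists>h. Suc h < ?m \<and> N h \<and> \<not> N (Suc h)"
      using exists_least_lemma[of "\<lambda>i. i < ?m \<and> \<not> N i"] 4(1,3) Suc_lessD by blast
    then obtain h where h: "Suc h < ?m" "N h" "\<not> N (Suc h)"
      by blast
    have h2: "Suc (Suc h) < ?m"
    proof (rule ccontr)
      assume "\<not> ?thesis"
      with h(1) have "?m - 1 = Suc h"
        by simp
      with 4(2) h(3) show False
        by simp
    qed
    have h': "h < ?m" "h \<noteq> Suc h" "h \<noteq> Suc (Suc h)" "Suc h \<noteq> Suc (Suc h)"
      using h by auto
    have hi: "(p ! h, p ! Suc h) \<in> E"
      using edge[OF h'(1) h(1)] h by simp
    consider "\<not> N (Suc (Suc h))"
      | j where "N (Suc (Suc h))" "j < ?m" "N j" "j \<noteq> h" "j \<noteq> Suc (Suc h)"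
      | "N (Suc (Suc h))" "\<And>j. j < ?m \<Longrightarrow> N j \<Longrightarrow> j = h \<or> j = Suc (Suc h)"
      by blast
    then have False
    proof cases
      case 1
      let ?l = "?m - 1"
      have l: "?l < ?m" "Suc (Suc h) \<noteq> ?l" "Suc h \<noteq> ?l" "h \<noteq> ?l" "N ?l" "Suc (Suc h) < ?l"
        using h2 1 4(2) by (auto intro: le_neq_implies_less)
      obtain q where q: "graph_path (V - {p ! h}) (local_compl E (p ! h)) q"
        using all mem h'(1) by blast
      \<comment> \<open>At \<open>p ! h\<close>: the vertex \<open>p ! Suc h\<close> keeps its successor and gains \<open>v\<close> and the last vertex.\<close>
      have "(p ! Suc h, p ! Suc (Suc h)) \<in> E" "(p ! Suc h, p ! ?l) \<notin> E" "(p ! Suc h, v) \<notin> E"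
        using edge[OF h(1) h2] edge[OF h(1) l(1)] h l(2-6) by (simp_all add: nbv)
      moreover have "(p ! h, p ! Suc (Suc h)) \<notin> E" "(p ! h, p ! ?l) \<in> E" "(p ! h, v) \<in> E"
        using edge[OF h'(1) h2] edge[OF h'(1) l(1)] h l(2-6) 1 by (simp_all add: nbv)
      moreover have "p ! Suc h \<noteq> p ! ?l" "p ! Suc h \<noteq> v"
        using neq[OF h(1) l(1)] l mem(2)[OF h(1)] by simp_all
      ultimately have "(p ! Suc h, p ! Suc (Suc h)) \<in> local_compl E (p ! h)"
          "(p ! Suc h, p ! ?l) \<in> local_compl E (p ! h)" "(p ! Suc h, v) \<in> local_compl E (p ! h)"
        using hi by (simp_all add: local_compl_def)
      moreover have "p ! Suc h \<in> V - {p ! h}" "p ! Suc (Suc h) \<in> V - {p ! h}" "p ! ?l \<in> V - {p ! h}" "v \<in> V - {p ! h}"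
        using mem[OF h(1)] mem[OF h2] mem[OF l(1)] mem[OF h'(1)] v l
          neq[OF h(1) h'(1)] neq[OF h2 h'(1)] neq[OF l(1) h'(1)] by auto
      moreover have "p ! Suc (Suc h) \<noteq> p ! ?l" "p ! Suc (Suc h) \<noteq> v" "p ! ?l \<noteq> v"
        using mem(2)[OF h2] mem(2)[OF l(1)] l neq[OF h2 l(1)] by simp_all
      ultimately show False
        using graph_path_no_claw[OF q] by blast
    next
      case (2 j)
      obtain q where q: "graph_path (V - {p ! Suc h}) (local_compl E (p ! Suc h)) q"
        using all mem h(1) by blast
      \<comment> \<open>At \<open>p ! Suc h\<close>: the edges at \<open>v\<close> stay, and \<open>v\<close> has three neighbours.\<close>
      have "(p ! Suc h, v) \<notin> E" "j \<noteq> Suc h"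
        using 2(3) h(3) by (auto simp: nbv)
      then have "(v, p ! h) \<in> local_compl E (p ! Suc h)" "(v, p ! Suc (Suc h)) \<in> local_compl E (p ! Suc h)"
          "(v, p ! j) \<in> local_compl E (p ! Suc h)"
        using h(2) 2(1,3) by (simp_all add: local_compl_def N_def)
      moreover have "v \<in> V - {p ! Suc h}" "p ! h \<in> V - {p ! Suc h}" "p ! Suc (Suc h) \<in> V - {p ! Suc h}"
          "p ! j \<in> V - {p ! Suc h}"
        using mem[OF h(1)] mem[OF h2] mem[OF 2(2)] mem[OF h'(1)] v \<open>j \<noteq> Suc h\<close>
          neq[OF h'(1) h(1)] neq[OF h2 h(1)] neq[OF 2(2) h(1)] by auto
      moreover have "p ! h \<noteq> p ! Suc (Suc h)" "p ! h \<noteq> p ! j" "p ! Suc (Suc h) \<noteq> p ! j"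
        using neq[OF h'(1) h2] neq[OF h'(1) 2(2)] neq[OF h2 2(2)] 2(4,5) by auto
      ultimately show False
        using graph_path_no_claw[OF q] by blast
    next
      case 3
      \<comment> \<open>Here \<open>E\<close> is the diamond, and local complementation at \<open>p ! 0\<close> isolates \<open>p ! 2\<close>.\<close>
      have h0: "h = 0"
        using 3(2)[of 0] 4(1) m by force
      have "?m - 1 < ?m"
        using m by linarith
      then have m3: "?m = 3"
        using 3(2)[of "?m - 1"] 4(2) h0 m by linarith
      have lt: "0 < ?m" "1 < ?m" "2 < ?m"
        using m3 by simp_all
      obtain q where q: "graph_path (V - {p ! 0}) (local_compl E (p ! 0)) q"
        using all mem[OF lt(1)] by blast
      have N: "N 0" "\<not> N 1" "N 2"
        using h 3(1) h0 by (simp_all add: numeral_2_eq_2)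
      have V: "V = {v, p ! 0, p ! 1, p ! 2}"
      proof -
        have "x \<in> {v, p ! 0, p ! 1, p ! 2}" if x: "x \<in> V" for x
        proof (cases "x = v")
          case False
          then obtain j where "j < ?m" "x = p ! j"
            using x graph_path_obtain_index[OF p, of x] by blast
          moreover from \<open>j < ?m\<close> have "j = 0 \<or> j = 1 \<or> j = 2"
            using m3 by linarith
          ultimately show ?thesis
            by auto
        qed simp
        then show ?thesis
          using v mem(1)[OF lt(1)] mem(1)[OF lt(2)] mem(1)[OF lt(3)] by blast
      qed
      have "(p ! 0, p ! 1) \<in> E" "(p ! 0, p ! 2) \<in> E" "(p ! 0, v) \<in> E" "(p ! 2, p ! 1) \<in> E" "(p ! 2, v) \<in> E"
        using edge[OF lt(1,2)] edge[OF lt(1,3)] edge[OF lt(3,2)] N by (simp_all add: nbv)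
      moreover have "p ! 2 \<noteq> p ! 1" "p ! 2 \<noteq> v" "p ! 2 \<noteq> p ! 0"
        using neq[OF lt(3,2)] neq[OF lt(3,1)] mem(2)[OF lt(3)] by simp_all
      ultimately have "(p ! 2, w) \<notin> local_compl E (p ! 0)" if "w \<in> V - {p ! 0}" for w
        using that irr[of "p ! 2"] unfolding V by (auto simp: local_compl_def)
      moreover have "p ! 2 \<in> V - {p ! 0}" "v \<in> V - {p ! 0}" "p ! 2 \<noteq> v"
        using neq[OF lt(3,1)] mem[OF lt(3)] mem[OF lt(1)] v by auto
      ultimately show False
        using graph_path_neighbour[OF q] by blast
    qed
    then show ?thesis ..
  qed
qed

text \<open>
  Induction on the number of vertices: with at least three vertices, some elimination step leads
  to a smaller graph that is not a path. The only graph without such a step consists of two isolated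
  vertices, whose adjacency matrix is zero.
\<close>

lemma large_null_space_if_not_path:
  assumes "finite V" "V \<noteq> {}" "sym E" "irrefl E" "\<nexists>p. graph_path V E p"
  shows "\<exists>k\<in>null_space_sizes V E. 2 < k"
  using assms
proof (induction "card V" arbitrary: V E rule: less_induct)
  case less
  show ?case
  proof (cases "3 \<le> card V")
    case True
    then obtain v where v: "v \<in> V" "\<nexists>p. graph_path (V - {v}) (local_compl E v) p"
      using graph_path_of_local_compl[OF less.prems(1) True less.prems(3,4)] less.prems(5) by blast
    have "V - {v} \<noteq> {}"
    proof
      assume "V - {v} = {}"
      with v(1) have "V = {v}"
        by blast
      with True show False
        by simp
    qed
    then have "\<exists>k\<in>null_space_sizes (V - {v}) (local_compl E v). 2 < k"
      using less.prems v
      by (intro less.hyps[OF card_Diff1_less]) (auto simp: local_compl_sym local_compl_irrefl)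
    then show ?thesis
      using null_space_sizes_local_compl[OF less.prems(1) v(1) less.prems(3,4)] by blast
  next
    case False
    have irr: "(a, a) \<notin> E" for a
      using less.prems(4) by (simp add: irrefl_def)
    have "card V \<noteq> 1"
    proof
      assume "card V = 1"
      then obtain a where "V = {a}"
        by (auto simp: card_1_singleton_iff)
      then have "graph_path V E [a]"
        using irr by (simp add: graph_path_def)
      with less.prems(5) show False
        by blast
    qed
    moreover have "card V \<noteq> 0"
      using less.prems(1,2) by simp
    ultimately have "card V = 2"
      using False by linarith
    then obtain a b where ab: "V = {a, b}" "a \<noteq> b"
      by (auto simp: card_2_iff)
    have "(a, b) \<notin> E"
    proof
      assume "(a, b) \<in> E"
      then have "graph_path V E [a, b]"
        using ab irr less.prems(3) by (auto simp: graph_path_def less_Suc_eq dest: symD)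
      with less.prems(5) show False
        by blast
    qed
    moreover then have "(b, a) \<notin> E"
      using less.prems(3) by (auto dest: symD)
    ultimately have zero: "adj E {} u w = 0" if "u \<in> V" "w \<in> V" for u w
      using that ab irr by (auto simp: adj_def)
    let ?z = "\<lambda>_. 0 :: bit"
    have sub: "{?z, ?z(a := 1), ?z(b := 1)} \<subseteq> null_space V (adj E {})"
      using ab zero by (auto simp: null_space_def)
    have "card {?z, ?z(a := 1), ?z(b := 1)} = 3"
      using ab(2) by (auto simp: fun_eq_iff card_insert_if)
    moreover have "finite (null_space V (adj E {}))"
    proof -
      have "inj_on (\<lambda>x. (x a, x b)) (null_space V (adj E {}))"
        by (rule inj_onI) (force simp: null_space_def ab(1) fun_eq_iff)
      moreover have "(\<lambda>x. (x a, x b)) ` null_space V (adj E {}) \<subseteq> {0, 1} \<times> {0, 1}"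
        by (auto intro: bit.exhaust)
      ultimately show ?thesis
        by (meson finite.emptyI finite.insertI finite_SigmaI inj_on_finite)
    qed
    ultimately have "2 < card (null_space V (adj E {}))"
      using card_mono[OF _ sub] by simp
    moreover have "card (null_space V (adj E {})) \<in> null_space_sizes V E"
      by (auto simp: null_space_sizes_def)
    ultimately show ?thesis
      by blast
  qed
qed

section \<open>The partial Petrial polynomial\<close>

lemma card_mat_kernel_adj_loop_mat:
  assumes G: "irrefl (parcs G)" and v: "bij_betw v {..<n} (pverts G)"
  shows "card (mat_kernel (adj_loop_mat G v n L)) = card (null_space (pverts G) (adj (parcs G) L))"
proof -
  let ?A = "adj_loop_mat G v n L" and ?V = "pverts G" and ?a = "adj (parcs G) L"
  have A: "?A \<in> carrier_mat n n"
    by (simp add: adj_loop_mat_def)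
  have inj: "v i = v j \<longleftrightarrow> i = j" if "i < n" "j < n" for i j
    using bij_betw_imp_inj_on[OF v] that by (simp add: inj_on_eq_iff)
  have entry: "?A $$ (i, j) = ?a (v i) (v j)" if "i < n" "j < n" for i j
    using that inj[OF that] G by (auto simp: adj_loop_mat_def adj_def irrefl_def)
  have prod: "(?A *\<^sub>v vec n (\<lambda>i. x (v i))) $ i = (\<Sum>w\<in>?V. ?a (v i) w * x w)" if i: "i < n" for x i
  proof -
    have "(?A *\<^sub>v vec n (\<lambda>i. x (v i))) $ i = (\<Sum>j = 0..<n. ?A $$ (i, j) * x (v j))"
      using A i by (auto simp: scalar_prod_def intro!: sum.cong)
    also have "\<dots> = (\<Sum>j\<in>{..<n}. ?a (v i) (v j) * x (v j))"
      using entry[OF i] by (intro sum.cong) auto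
    also have "\<dots> = (\<Sum>w\<in>?V. ?a (v i) w * x w)"
      by (rule sum.reindex_bij_betw[OF v])
    finally show ?thesis .
  qed
  have kernel: "vec n (\<lambda>i. x (v i)) \<in> mat_kernel ?A \<longleftrightarrow> (\<forall>u\<in>?V. (\<Sum>w\<in>?V. ?a u w * x w) = 0)" for x
  proof -
    have "vec n (\<lambda>i. x (v i)) \<in> mat_kernel ?A \<longleftrightarrow> (\<forall>i<n. (?A *\<^sub>v vec n (\<lambda>i. x (v i))) $ i = 0)"
      unfolding mat_kernel[OF A] using A by (auto simp: vec_eq_iff)
    also have "\<dots> \<longleftrightarrow> (\<forall>u\<in>v ` {..<n}. (\<Sum>w\<in>?V. ?a u w * x w) = 0)"
      using prod by auto
    finally show ?thesis
      by (simp only: bij_betw_imp_surj_on[OF v])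
  qed
  let ?g = "\<lambda>w u. if u \<in> ?V then w $ inv_into {..<n} v u else 0"
  have inv: "inv_into {..<n} v (v i) = i" "v i \<in> ?V" if "i < n" for i
    using v that by (auto simp: bij_betw_def)
  have vec_g: "vec n (\<lambda>i. ?g w (v i)) = w" if "w \<in> carrier_vec n" for w
    using that inv by (auto simp: vec_eq_iff)
  have "bij_betw (\<lambda>x. vec n (\<lambda>i. x (v i))) (null_space ?V ?a) (mat_kernel ?A)"
  proof (rule bij_betwI[where g = ?g])
    show "(\<lambda>x. vec n (\<lambda>i. x (v i))) \<in> null_space ?V ?a \<rightarrow> mat_kernel ?A"
      by (simp add: kernel null_space_def Pi_def)
    show "?g \<in> mat_kernel ?A \<rightarrow> null_space ?V ?a"
    proof
      fix w assume w: "w \<in> mat_kernel ?A"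
      then have "vec n (\<lambda>i. ?g w (v i)) \<in> mat_kernel ?A"
        using vec_g[of w] mat_kernel_carrier[OF A] by (simp only: subset_iff)
      then have "\<forall>u\<in>?V. (\<Sum>x\<in>?V. ?a u x * ?g w x) = 0"
        by (rule iffD1[OF kernel[of "?g w"]])
      then show "?g w \<in> null_space ?V ?a"
        unfolding null_space_def mem_Collect_eq by (intro conjI) (simp, assumption)
    qed
    show "?g (vec n (\<lambda>i. x (v i))) = x" if x: "x \<in> null_space ?V ?a" for x
    proof
      fix u
      show "?g (vec n (\<lambda>i. x (v i))) u = x u"
      proof (cases "u \<in> ?V")
        case True
        then obtain i where "i < n" "u = v i"
          using v by (auto simp: bij_betw_def)
        then show ?thesis
          using inv by simp
      next
        case False
        then show ?thesis
          using x by (simp add: null_space_def)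
      qed
    qed
    show "vec n (\<lambda>i. ?g w (v i)) = w" if "w \<in> mat_kernel ?A" for w
      using vec_g mat_kernel_carrier[OF A] that by blast
  qed
  then show ?thesis
    by (rule bij_betw_same_card[symmetric])
qed

text \<open>
  The arcs of both digraphs are pairs with the projections as tail and head, which forces an
  isomorphism to act on an arc by its vertex map. The positions in the list are the images of the vertices.
\<close>

lemma is_path_iff_graph_path:
  assumes G: "wf_digraph (with_proj G)"
  shows "is_path G \<longleftrightarrow> (\<exists>p. graph_path (pverts G) (parcs G) p)"
proof
  let ?V = "pverts G" and ?E = "parcs G"
  assume "is_path G"
  then obtain m f where m: "1 \<le> m" and f: "pre_digraph.digraph_isomorphism (with_proj G) f"
      "with_proj (path_graph m) = app_iso f (with_proj G)"
    by (auto simp: is_path_def digraph_iso_def)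
  let ?h = "iso_verts f"
  have inj: "inj_on ?h ?V" and img: "?h ` ?V = {..<m}"
    using f(1) arg_cong[OF f(2), of verts]
    by (auto simp: pre_digraph.digraph_isomorphism_def path_graph_def)
  have arcs: "iso_arcs f ` ?E = {(i, j). i < m \<and> j < m \<and> (j = i + 1 \<or> i = j + 1)}"
    using arg_cong[OF f(2), of arcs] by (simp add: path_graph_def)
  have "iso_tail f = fst" "iso_head f = snd"
    using arg_cong[OF f(2), of tail] arg_cong[OF f(2), of head] by simp_all
  then have arc: "iso_arcs f (x, y) = (?h x, ?h y)" if "(x, y) \<in> ?E" for x y
    using f(1) that by (force simp: pre_digraph.digraph_isomorphism_def prod_eq_iff)
  define p where "p = map (inv_into ?V ?h) [0..<m]"
  have hp: "?h (p ! i) = i" "p ! i \<in> ?V" if "i < m" for i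
    using that img f_inv_into_f[of i ?h ?V] inv_into_into[of i ?h ?V] by (auto simp: p_def)
  have "graph_path ?V ?E p"
    unfolding graph_path_def
  proof (intro conjI allI impI)
    show "p \<noteq> []"
      using m by (simp add: p_def)
    show "distinct p"
      using img by (simp add: p_def distinct_map inj_on_inv_into lessThan_atLeast0)
    show "set p = ?V"
      using inv_into_image_cancel[OF inj subset_refl] by (simp add: p_def img lessThan_atLeast0)
    fix i j assume "i < length p" "j < length p"
    then have ij: "i < m" "j < m"
      by (simp_all add: p_def)
    show "(p ! i, p ! j) \<in> ?E \<longleftrightarrow> j = Suc i \<or> i = Suc j"
    proof
      assume e: "(p ! i, p ! j) \<in> ?E"
      then have "(i, j) \<in> iso_arcs f ` ?E"
        using arc[OF e] hp ij by (metis image_eqI)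
      then show "j = Suc i \<or> i = Suc j"
        unfolding arcs by simp
    next
      assume "j = Suc i \<or> i = Suc j"
      then have "(i, j) \<in> iso_arcs f ` ?E"
        unfolding arcs using ij by simp
      then obtain x y where xy: "(x, y) \<in> ?E" "(i, j) = iso_arcs f (x, y)"
        by auto
      have "x \<in> ?V" "y \<in> ?V"
        using wf_digraph.tail_in_verts[OF G] wf_digraph.head_in_verts[OF G] xy(1) by force+
      then have "p ! i = x" "p ! j = y"
        using arc[OF xy(1)] xy(2) ij inj by (auto simp: p_def)
      then show "(p ! i, p ! j) \<in> ?E"
        using xy(1) by simp
    qed
  qed
  then show "\<exists>p. graph_path ?V ?E p" ..
next
  let ?V = "pverts G" and ?E = "parcs G"
  assume "\<exists>p. graph_path ?V ?E p"
  then obtain p where p: "graph_path ?V ?E p" ..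
  let ?m = "length p"
  have "bij_betw (nth p) {..<?m} ?V"
    using p by (auto simp: graph_path_def intro: bij_betw_nth)
  then have inv: "bij_betw (the_inv_into {..<?m} (nth p)) ?V {..<?m}"
    by (rule bij_betw_the_inv_into)
  define h where "h = the_inv_into {..<?m} (nth p)"
  have ph: "h (p ! i) = i" if "i < ?m" for i
    using p that unfolding h_def by (intro the_inv_into_f_f) (auto simp: graph_path_def inj_on_nth)
  let ?F = "\<lambda>(x, y). (h x, h y)"
  define f where "f = \<lparr>iso_verts = h, iso_arcs = ?F, iso_head = snd, iso_tail = fst\<rparr>"
  have sub: "?E \<subseteq> ?V \<times> ?V"
    using wf_digraph.tail_in_verts[OF G] wf_digraph.head_in_verts[OF G] by force
  have inj: "inj_on h ?V" and img: "h ` ?V = {..<?m}"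
    using inv by (auto simp: h_def bij_betw_def)
  have "inj_on ?F ?E"
    by (rule inj_onI) (use sub inj in \<open>auto dest: inj_onD\<close>)
  then have "pre_digraph.digraph_isomorphism (with_proj G) f"
    using G inj by (auto simp: pre_digraph.digraph_isomorphism_def f_def)
  moreover have "?F ` ?E = {(i, j). i < ?m \<and> j < ?m \<and> (j = i + 1 \<or> i = j + 1)}" (is "_ = ?P")
  proof
    show "?F ` ?E \<subseteq> ?P"
    proof
      fix a assume "a \<in> ?F ` ?E"
      then obtain x y where xy: "(x, y) \<in> ?E" "a = (h x, h y)"
        by auto
      then have "x \<in> ?V" "y \<in> ?V"
        using sub by auto
      then obtain i j where "i < ?m" "x = p ! i" "j < ?m" "y = p ! j"
        using graph_path_obtain_index[OF p] by metis
      then show "a \<in> ?P"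
        using xy ph graph_path_edge[OF p] by auto
    qed
    show "?P \<subseteq> ?F ` ?E"
    proof
      fix a assume "a \<in> ?P"
      then obtain i j where "a = (i, j)" "i < ?m" "j < ?m" "(p ! i, p ! j) \<in> ?E"
        using graph_path_edge[OF p] by auto
      then show "a \<in> ?F ` ?E"
        by (intro image_eqI[of _ _ "(p ! i, p ! j)"]) (simp_all add: ph)
    qed
  qed
  ultimately have "digraph_iso (with_proj G) (with_proj (path_graph ?m))"
    unfolding digraph_iso_def
    by (intro exI[of _ f] conjI pre_digraph.equality) (simp_all add: f_def path_graph_def img)
  moreover have "1 \<le> ?m"
    using p by (simp add: graph_path_def Suc_le_eq)
  ultimately show "is_path G"
    unfolding is_path_def by blast
qed

text \<open>
  The exponents that occur are the ranks \<open>r\<close>, as no terms cancel, and \<open>r\<close> corresponds to null spaces of size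
  \<open>2 ^ (n - r)\<close>, which is injective in \<open>r\<close> because \<open>r \<le> n\<close>.
\<close>

lemma card_coeff_partial_petrial_poly:
  assumes G: "irrefl (parcs G)" and v: "bij_betw v {..<n} (pverts G)"
  shows "card {k. coeff (partial_petrial_poly G v n) k \<noteq> 0} = card (null_space_sizes (pverts G) (parcs G))"
proof -
  let ?V = "pverts G"
  define r where "r L = vec_space.rank n (adj_loop_mat G v n L)" for L
  have A: "adj_loop_mat G v n L \<in> carrier_mat n n" for L
    by (simp add: adj_loop_mat_def)
  have r_le: "r L \<le> n" for L
    unfolding r_def by (rule vec_space.rank_le_nc[OF A])
  have fin: "finite (Pow ?V)"
    using v bij_betw_finite by auto
  have "coeff (partial_petrial_poly G v n) k \<noteq> 0 \<longleftrightarrow> k \<in> r ` Pow ?V" for k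
  proof -
    have "coeff (partial_petrial_poly G v n) k = (\<Sum>L\<in>Pow ?V. if r L = k then 1 else 0)"
      using r_le by (simp add: partial_petrial_poly_def corank_def coeff_sum flip: r_def)
    also have "\<dots> = int (card {L \<in> Pow ?V. r L = k})"
      using fin by (simp add: sum.If_cases Int_def)
    finally show ?thesis
      using fin by (auto simp: card_eq_0_iff)
  qed
  then have "{k. coeff (partial_petrial_poly G v n) k \<noteq> 0} = r ` Pow ?V"
    by auto
  moreover have "null_space_sizes ?V (parcs G) = (\<lambda>k. 2 ^ (n - k)) ` r ` Pow ?V"
  proof -
    have "(UNIV :: bit set) = {0, 1}"
      by (auto intro: bit.exhaust)
    then have univ: "finite (UNIV :: bit set)" "card (UNIV :: bit set) = 2"
      by (metis finite.emptyI finite.insertI, metis card_2_iff zero_neq_one)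
    have "card (null_space ?V (adj (parcs G) L)) = 2 ^ (n - r L)" for L
    proof -
      have "card (null_space ?V (adj (parcs G) L)) * 2 ^ r L = 2 ^ n"
        using vec_space.card_mat_kernel_rank[OF A univ(1), of L]
        by (simp only: card_mat_kernel_adj_loop_mat[OF G v] r_def univ(2))
      also have "(2 :: nat) ^ n = 2 ^ (n - r L) * 2 ^ r L"
        using r_le[of L] by (simp flip: power_add)
      finally show ?thesis
        by simp
    qed
    then show ?thesis
      by (simp add: null_space_sizes_def image_image)
  qed
  moreover have "inj_on (\<lambda>k. 2 ^ (n - k) :: nat) (r ` Pow ?V)"
  proof (rule inj_onI)
    fix k l assume "k \<in> r ` Pow ?V" "l \<in> r ` Pow ?V" "(2 :: nat) ^ (n - k) = 2 ^ (n - l)"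
    then have "k \<le> n" "l \<le> n" "n - k = n - l"
      using r_le by auto
    then show "k = l"
      by linarith
  qed
  ultimately show ?thesis
    by (simp add: card_image)
qed

theorem theorem13:
  fixes G :: "'a pair_pre_digraph" and v :: "nat \<Rightarrow> 'a" and n :: nat
  assumes "pair_graph G"
    and "Digraph_Component.connected (with_proj G)"
    and "bij_betw v {..<n} (pverts G)"
  shows "binomial_poly (partial_petrial_poly G v n) \<longleftrightarrow> is_path G"
proof -
  interpret pair_graph G
    by fact
  let ?V = "pverts G" and ?E = "parcs G" and ?K = "null_space_sizes (pverts G) (parcs G)"
  have V: "finite ?V" "?V \<noteq> {}"
    using assms(2) by (auto simp: connected_def strongly_connected_def mk_symmetric_def)
  have E: "sym ?E" "irrefl ?E"
    using arcs_symmetric no_loops[of "(a, a)" for a] by (fastforce simp: sym_def irrefl_def)+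
  have K: "{1, 2} \<subseteq> ?K" "finite ?K"
    using one_two_in_null_space_sizes[OF V E] V by (auto simp: null_space_sizes_def)
  have "binomial_poly (partial_petrial_poly G v n) \<longleftrightarrow> card ?K = 2"
    by (simp add: binomial_poly_def card_coeff_partial_petrial_poly[OF E(2) assms(3)])
  also have "\<dots> \<longleftrightarrow> ?K = {1, 2}"
  proof
    assume "card ?K = 2"
    then have "card {1, 2 :: nat} = card ?K"
      by simp
    then show "?K = {1, 2}"
      by (rule card_subset_eq[OF K(2,1), symmetric])
  qed simp
  also have "\<dots> \<longleftrightarrow> (\<exists>p. graph_path ?V ?E p)"
  proof
    assume "?K = {1, 2}"
    then have "\<not> (\<exists>k\<in>?K. 2 < k)"
      by simp
    then show "\<exists>p. graph_path ?V ?E p"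
      using large_null_space_if_not_path[OF V E] by blast
  next
    assume "\<exists>p. graph_path ?V ?E p"
    then show "?K = {1, 2}"
      using K(1) null_space_sizes_path by (metis subset_antisym)
  qed
  also have "\<dots> \<longleftrightarrow> is_path G"
    using is_path_iff_graph_path[of G] wf_digraph_axioms by simp
  finally show ?thesis .
qed

end
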